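(* Let $\mathbf{G}=(S,E)$ be a graph which is feasible for a set of functions $(V_s)_{s\in S}$ with respect to the switching system $x(t+1)=f_{\sigma(t)}(x(t))$ on $\mathbb{R}^n$ with modes $[M]=\{1,\dots,M\}$. Let $P$ and $Q$ be two subsets of $S$. If, for some $\sigma\in[M]$, there is a subset $E'$ of $E$ such that $$\forall p\in P,\ \exists!\, q\in Q:\ (p,q,\sigma)\in E',\qquad \forall q\in Q,\ \exists!\, p\in P:\ (p,q,\sigma)\in E',$$ then $$\sum_{q\in Q}V_q(f_\sigma(x))\le\sum_{p\in P}V_p(x)\qquad\forall x\in\mathbb{R}^n.$$
   Context: System: $M\ge1$, each $f_i:\mathbb{R}^n\to\mathbb{R}^n$ ($i\in[M]$) is continuous with $f_i(x)=0\Leftrightarrow x=0$. A graph $\mathbf{G}=(S,E)$ is a directed labeled graph with finite node set $S$ and edge set $E\subseteq S\times S\times[M]$, an edge $(p,q,\sigma)$ going from $p$ to $q$ with label $\sigma$. $\mathbf{G}$ is feasible for functions $V_s:\mathbb{R}^n\to\mathbb{R}^+$ ($s\in S$) if $V_q(f_\sigma(x))\le V_p(x)$ for all $(p,q,\sigma)\in E$ and all $x\in\mathbb{R}^n$. *)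

theory Defs
  imports "HOL-Analysis.Analysis"
begin

text \<open>Modes are the natural numbers \<open>1, \<dots>, M\<close>; outside this range \<open>f\<close> is unconstrained.
  The trajectories are those of \<open>x (t + 1) = f (\<sigma> t) (x t)\<close>.\<close>

definition switching_system :: "nat \<Rightarrow> (nat \<Rightarrow> real ^ 'n \<Rightarrow> real ^ 'n) \<Rightarrow> bool" where
  "switching_system M f \<longleftrightarrow>
     M \<ge> 1 \<and> (\<forall>i\<in>{1..M}. continuous_on UNIV (f i) \<and> (\<forall>x. f i x = 0 \<longleftrightarrow> x = 0))"

definition labeled_graph :: "nat \<Rightarrow> 's set \<Rightarrow> ('s \<times> 's \<times> nat) set \<Rightarrow> bool" where
  "labeled_graph M S E \<longleftrightarrow> finite S \<and> E \<subseteq> S \<times> S \<times> {1..M}"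

definition feasible ::
  "('s \<times> 's \<times> nat) set \<Rightarrow> (nat \<Rightarrow> real ^ 'n \<Rightarrow> real ^ 'n) \<Rightarrow> ('s \<Rightarrow> real ^ 'n \<Rightarrow> real) \<Rightarrow> bool" where
  "feasible E f V \<longleftrightarrow> (\<forall>(p, q, \<sigma>)\<in>E. \<forall>x. V q (f \<sigma> x) \<le> V p x)"

end

theory Submission
  imports Defs
begin

text \<open>The two unique-existence conditions say that the \<open>\<sigma>\<close>-labeled edges
  of \<open>E'\<close> from \<open>P\<close> to \<open>Q\<close> form a perfect matching, hence the
  graph of a bijection \<open>g\<close> from \<open>P\<close> onto \<open>Q\<close>. Reindexing the
  sum over \<open>Q\<close> along \<open>g\<close> pairs each \<open>V (g p) (f \<sigma> x)\<close>
  with \<open>V p x\<close>, and feasibility along the edge from \<open>p\<close> to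
  \<open>g p\<close> gives the inequality term by term.\<close>

theorem proposition4:
  fixes M :: nat and f :: "nat \<Rightarrow> real ^ 'n \<Rightarrow> real ^ 'n"
    and S :: "'s set" and E E' :: "('s \<times> 's \<times> nat) set"
    and V :: "'s \<Rightarrow> real ^ 'n \<Rightarrow> real"
    and P Q :: "'s set" and \<sigma> :: nat
  assumes "switching_system M f"
    and "labeled_graph M S E"
    and "\<forall>s\<in>S. \<forall>x. V s x \<ge> 0"
    and "feasible E f V"
    and "P \<subseteq> S" and "Q \<subseteq> S"
    and "\<sigma> \<in> {1..M}"
    and "E' \<subseteq> E"
    and "\<forall>p\<in>P. \<exists>!q\<in>Q. (p, q, \<sigma>) \<in> E'"
    and "\<forall>q\<in>Q. \<exists>!p\<in>P. (p, q, \<sigma>) \<in> E'"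
  shows "\<forall>x. (\<Sum>q\<in>Q. V q (f \<sigma> x)) \<le> (\<Sum>p\<in>P. V p x)"
proof
  fix x
  obtain g where g: "\<And>p. p \<in> P \<Longrightarrow> g p \<in> Q \<and> (p, g p, \<sigma>) \<in> E'"
    using assms(9) by metis
  have "bij_betw g P Q"
  proof (rule bij_betw_imageI)
    \<comment> \<open>Nodes of \<open>P\<close> with a common image \<open>q\<close> are both
      sources of \<open>\<sigma>\<close>-edges into \<open>q\<close>, so uniqueness of the source
      identifies them.\<close>
    show "inj_on g P"
      using g assms(10) by (metis inj_onI)
    show "g ` P = Q"
    proof
      show "g ` P \<subseteq> Q"
        using g by blast
      show "Q \<subseteq> g ` P"
      proof
        fix q assume "q \<in> Q"
        then obtain p where "p \<in> P" "(p, q, \<sigma>) \<in> E'"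
          using assms(10) by blast
        \<comment> \<open>Both \<open>q\<close> and \<open>g p\<close> are targets in
          \<open>Q\<close> of \<open>\<sigma>\<close>-edges leaving \<open>p\<close>; such a target
          is unique.\<close>
        with g \<open>q \<in> Q\<close> assms(9) have "q = g p"
          by blast
        with \<open>p \<in> P\<close> show "q \<in> g ` P"
          by blast
      qed
    qed
  qed
  then have "(\<Sum>q\<in>Q. V q (f \<sigma> x)) = (\<Sum>p\<in>P. V (g p) (f \<sigma> x))"
    by (rule sum.reindex_bij_betw[symmetric])
  also have "\<dots> \<le> (\<Sum>p\<in>P. V p x)"
    using g assms(4,8) by (intro sum_mono) (fastforce simp: feasible_def)
  finally show "(\<Sum>q\<in>Q. V q (f \<sigma> x)) \<le> (\<Sum>p\<in>P. V p x)" .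
qed

end
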